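(* Let $f:\mathbb{R}^p\times\mathbb{R}^2\to\mathbb{R}$ be any feed-forward network family as defined in the context (with input dimension $d=2$), let $\mathcal{A}$ be any deterministic first-order algorithm, and let $\rho$ be any rotationally invariant sampling distribution on $\mathbb{R}^p$ (i.e. $\rho(\theta)=\rho(V\theta)$ for every $\theta\in\mathbb{R}^p$ and $V\in O(p)$). For any $\gamma\in\mathbb{R}$, let $V_\gamma\in O(p)$ be the eigenvector matrix of $\mathrm{EGOP}_\rho(\mathcal{L}^{(\gamma)}(\cdot;f))$, let $f_\gamma(\theta;x):=f(V_\gamma\theta;x)$, and let $\theta^{(\gamma)}_t$, $t=0,1,\dots,T$, denote the iterates obtained by running $\mathcal{A}$ for $T$ timesteps on the EGOP-reparameterized objective $\theta\mapsto\mathcal{L}^{(\gamma)}(\theta;f_\gamma)$ from initialization $\theta_0$ (the same $\theta_0$ for all $\gamma$). Then for every $\gamma\in\mathbb{R}$, every $x\in\mathbb{R}^2$ and every $t\in\{1,\dots,T\}$, $$f_\gamma\left(\theta^{(\gamma)}_t;x\right)=f_0\left(\theta^{(0)}_t;U(\gamma)^{\top}x\right).$$ Moreover, $\theta^{(\gamma)}_t=\theta^{(0)}_t$ for every $t\in\{1,\dots,T\}$.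
   Context: Networks. Fix input dimension $d$, a number $L\ge1$, widths $m_1,\dots,m_{L+1}$ with $m_{L+1}=1$, and activation functions $\sigma_2,\dots,\sigma_{L+1}$ applied entrywise. Parameters: $W_1\in\mathbb{R}^{m_1\times d}$, $W_j\in\mathbb{R}^{m_j\times m_{j-1}}$ for $2\le j\le L+1$, $b_j\in\mathbb{R}^{m_j}$, collected in $\theta=[\mathrm{vec}(W_1),\dots,\mathrm{vec}(W_{L+1}),b_1,\dots,b_{L+1}]\in\mathbb{R}^p$ ($\mathrm{vec}$ is column-major). Then $h_1(\theta;x)=x$, $h_j(\theta;x)=\sigma_j(W_{j-1}h_{j-1}(\theta;x)+b_{j-1})$ for $2\le j\le L+1$, and $f(\theta;x)=W_{L+1}h_{L+1}(\theta;x)+b_{L+1}$. Data. $\mathcal{D}$ is the law of $(x,y)\in\mathbb{R}^2\times\{\pm1\}$ with $y,\epsilon$ independent uniform on $\{\pm1\}$ and, given $(y,\epsilon)$, independent coordinates $x_1\sim\mathcal{N}\left(\frac{\mu_1-\mu_3}{2}+y\frac{\mu_1+\mu_3}{2},\sigma^2\right)$, $x_2\sim\mathcal{N}\left(\mu_2\epsilon\frac{y+1}{2},\sigma^2\right)$. $U(\gamma)=\begin{bmatrix}\cos\gamma&-\sin\gamma\\ \sin\gamma&\cos\gamma\end{bmatrix}$, and $\mathcal{D}^{(\gamma)}$ is the law of $(U(\gamma)x,y)$ for $(x,y)\sim\mathcal{D}$. For a forward map $g$, $\mathcal{L}^{(\gamma)}(\theta;g)=\mathbb{E}_{(x,y)\sim\mathcal{D}^{(\gamma)}}[-y\,g(\theta;x)]$,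 assumed finite for each $\theta$. EGOP. For a differentiable $\mathcal{L}:\mathbb{R}^p\to\mathbb{R}$, $\mathrm{EGOP}_\rho(\mathcal{L})=\mathbb{E}_{\theta\sim\rho}[\nabla\mathcal{L}(\theta)\nabla\mathcal{L}(\theta)^{\top}]$ (losses are assumed such that this is well defined). Convention on eigenbases: $V_\gamma\in O(p)$ has columns an orthonormal eigenbasis of $\mathrm{EGOP}_\rho(\mathcal{L}^{(\gamma)}(\cdot;f))$, and the choices are made consistently: letting $Q^{(\gamma)}\in O(p)$ be block diagonal with blocks $U(\gamma)^{\top}\otimes\mathbb{I}_{m_1}$ (acting on $\mathrm{vec}(W_1)$) and the identity, if $\mathrm{EGOP}_\rho(\mathcal{L}^{(\gamma)}(\cdot;f))=(Q^{(\gamma)})^{\top}\mathrm{EGOP}_\rho(\mathcal{L}^{(0)}(\cdot;f))\,Q^{(\gamma)}$ then the eigenvector matrix selected is $V_\gamma=(Q^{(\gamma)})^{\top}V_0$. Algorithms. A deterministic first-order algorithm, given an objective $\mathcal{L}$, generates iterates $\theta_{t+1}=\mathtt{update}(\{\theta_\tau\}_{\tau\le t},\{\nabla_\theta\mathcal{L}(\theta_\tau)\}_{\tau\le t})$ with $\mathtt{update}$ a fixed deterministic function. *)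

theory Defs
  imports "HOL-Probability.Probability"
begin

text \<open>
  Widths are given by \<open>m :: nat \<Rightarrow> nat\<close>, where \<open>m 0\<close> is the input dimension \<open>d\<close>, so the weight
  matrix \<open>W\<^sub>j\<close> has \<open>m j\<close> rows and \<open>m (j - 1)\<close> columns for every \<open>1 \<le> j \<le> L + 1\<close>.
  Rows, columns and the positions in a parameter vector are counted from \<open>0\<close>.
  A parameter vector is an element of \<open>real ^ 'p\<close> with \<open>CARD('p) = num_params m L\<close>;
  the type \<open>'p\<close> carries no order, so a bijection \<open>e\<close> from \<open>{..<num_params m L}\<close> onto \<open>'p\<close>
  says which coordinate comes first, second, and so on.
\<close>

definition num_params :: "(nat \<Rightarrow> nat) \<Rightarrow> nat \<Rightarrow> nat" where
  "num_params m L = (\<Sum>j=1..L+1. m j * m (j - 1)) + (\<Sum>j=1..L+1. m j)"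

text \<open>The ordering is \<open>[vec W\<^sub>1, \<dots>, vec W\<^bsub>L+1\<^esub>, b\<^sub>1, \<dots>, b\<^bsub>L+1\<^esub>]\<close> with column-major \<open>vec\<close>.\<close>

definition weight ::
  "(nat \<Rightarrow> nat) \<Rightarrow> (nat \<Rightarrow> 'p) \<Rightarrow> real ^ 'p \<Rightarrow> nat \<Rightarrow> nat \<Rightarrow> nat \<Rightarrow> real" where
  "weight m e \<theta> j r c = \<theta> $ e ((\<Sum>k=1..<j. m k * m (k - 1)) + c * m j + r)"

definition bias ::
  "(nat \<Rightarrow> nat) \<Rightarrow> nat \<Rightarrow> (nat \<Rightarrow> 'p) \<Rightarrow> real ^ 'p \<Rightarrow> nat \<Rightarrow> nat \<Rightarrow> real" where
  "bias m L e \<theta> j r = \<theta> $ e ((\<Sum>k=1..L+1. m k * m (k - 1)) + (\<Sum>k=1..<j. m k) + r)"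

definition affine_layer ::
  "(nat \<Rightarrow> nat) \<Rightarrow> nat \<Rightarrow> (nat \<Rightarrow> 'p) \<Rightarrow> real ^ 'p \<Rightarrow> nat \<Rightarrow> (nat \<Rightarrow> real) \<Rightarrow> nat \<Rightarrow> real" where
  "affine_layer m L e \<theta> j v r = (\<Sum>c<m (j - 1). weight m e \<theta> j r c * v c) + bias m L e \<theta> j r"

text \<open>
  \<open>hidden \<dots> k\<close> is \<open>h\<^bsub>k+1\<^esub>\<close>, which has width \<open>m k\<close>; only its entries below \<open>m k\<close> are meaningful.
  The activation between \<open>h\<^sub>j\<close> and \<open>h\<^bsub>j+1\<^esub>\<close> is \<open>act (j + 1)\<close>.
\<close>

primrec hidden ::
  "(nat \<Rightarrow> nat) \<Rightarrow> nat \<Rightarrow> (nat \<Rightarrow> real \<Rightarrow> real) \<Rightarrow> (nat \<Rightarrow> 'p) \<Rightarrow> real ^ 'p \<Rightarrow> (nat \<Rightarrow> real)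
    \<Rightarrow> nat \<Rightarrow> nat \<Rightarrow> real" where
  "hidden m L act e \<theta> x 0 = x"
| "hidden m L act e \<theta> x (Suc k) =
     (\<lambda>r. act (k + 2) (affine_layer m L e \<theta> (k + 1) (hidden m L act e \<theta> x k) r))"

text \<open>Since \<open>m (L + 1) = 1\<close>, the output is entry \<open>0\<close> of the last affine layer.\<close>

definition network ::
  "(nat \<Rightarrow> nat) \<Rightarrow> nat \<Rightarrow> (nat \<Rightarrow> real \<Rightarrow> real) \<Rightarrow> (nat \<Rightarrow> 'p) \<Rightarrow> real ^ 'p \<Rightarrow> real ^ 2 \<Rightarrow> real" where
  "network m L act e \<theta> x =
     affine_layer m L e \<theta> (L + 1)
       (hidden m L act e \<theta> (\<lambda>i. if i = 0 then x $ 1 else x $ 2) L) 0"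

definition reparam ::
  "real ^ 'p ^ 'p \<Rightarrow> (real ^ 'p \<Rightarrow> 'x \<Rightarrow> real) \<Rightarrow> real ^ 'p \<Rightarrow> 'x \<Rightarrow> real" where
  "reparam V f \<theta> x = f (V *v \<theta>) x"

definition rot2 :: "real \<Rightarrow> real ^ 2 ^ 2" where
  "rot2 \<gamma> = vector [vector [cos \<gamma>, - sin \<gamma>], vector [sin \<gamma>, cos \<gamma>]]"

definition data_law :: "real \<Rightarrow> real \<Rightarrow> real \<Rightarrow> real \<Rightarrow> ((real ^ 2) \<times> real) measure" where
  "data_law \<mu>1 \<mu>2 \<mu>3 s =
     measure_pmf (pmf_of_set ({-1, 1} \<times> {-1, 1})) \<bind>
       (\<lambda>(y :: real, \<epsilon> :: real).
         distr
           (density lborel (normal_density ((\<mu>1 - \<mu>3) / 2 + y * ((\<mu>1 + \<mu>3) / 2)) s) \<Otimes>\<^sub>M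
            density lborel (normal_density (\<mu>2 * \<epsilon> * ((y + 1) / 2)) s))
           borel (\<lambda>(x1, x2). (vector [x1, x2], y)))"

definition rotated_law ::
  "real \<Rightarrow> ((real ^ 2) \<times> real) measure \<Rightarrow> ((real ^ 2) \<times> real) measure" where
  "rotated_law \<gamma> D = distr D borel (\<lambda>(x, y). (rot2 \<gamma> *v x, y))"

definition loss ::
  "((real ^ 2) \<times> real) measure \<Rightarrow> ('t \<Rightarrow> real ^ 2 \<Rightarrow> real) \<Rightarrow> 't \<Rightarrow> real" where
  "loss D g \<theta> = (\<integral>(x, y). - y * g \<theta> x \<partial>D)"

definition gradient :: "('a::euclidean_space \<Rightarrow> real) \<Rightarrow> 'a \<Rightarrow> 'a" where
  "gradient l \<theta> = (THE g. GDERIV l \<theta> :> g)"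

definition grad_outer :: "(real ^ 'p \<Rightarrow> real) \<Rightarrow> real ^ 'p \<Rightarrow> real ^ 'p ^ 'p" where
  "grad_outer l \<theta> =
     (columnvector (gradient l \<theta>) :: real ^ 1 ^ 'p) ** (rowvector (gradient l \<theta>) :: real ^ 'p ^ 1)"

definition EGOP :: "(real ^ 'p) measure \<Rightarrow> (real ^ 'p \<Rightarrow> real) \<Rightarrow> real ^ 'p ^ 'p" where
  "EGOP \<rho> l = (\<integral>\<theta>. grad_outer l \<theta> \<partial>\<rho>)"

definition EGOP_well_defined :: "(real ^ 'p) measure \<Rightarrow> (real ^ 'p \<Rightarrow> real) \<Rightarrow> bool" where
  "EGOP_well_defined \<rho> l \<longleftrightarrow>
     (\<forall>\<theta>. l differentiable (at \<theta>)) \<and> integrable \<rho> (grad_outer l)"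

text \<open>
  Invariance is stated for the measure rather than for a density, so that laws without a
  density are covered too; the lemma \<open>rotationally_invariant_density\<close> below shows that an
  invariant density gives an invariant measure.
\<close>

definition rotationally_invariant :: "(real ^ 'p) measure \<Rightarrow> bool" where
  "rotationally_invariant \<rho> \<longleftrightarrow>
     (\<forall>V :: real ^ 'p ^ 'p. orthogonal_matrix V \<longrightarrow> distr \<rho> borel (\<lambda>\<theta>. V *v \<theta>) = \<rho>)"

lemma nn_integral_lborel_shift:
  fixes g :: "'a::euclidean_space \<Rightarrow> ennreal"
  assumes [measurable]: "g \<in> borel_measurable borel"
  shows "(\<integral>\<^sup>+x. g (c + x) \<partial>lborel) = (\<integral>\<^sup>+x. g x \<partial>lborel)"
proof -
  have "(\<integral>\<^sup>+x. g x \<partial>lborel) = (\<integral>\<^sup>+x. g x \<partial>distr lborel borel ((+) c))"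
    by (simp add: lborel_distr_plus)
  also have "\<dots> = (\<integral>\<^sup>+x. g (c + x) \<partial>lborel)"
    by (rule nn_integral_distr) simp_all
  finally show ?thesis ..
qed

lemma distr_lborel_orthogonal:
  fixes V :: "real ^ 'p ^ 'p"
  assumes V: "orthogonal_matrix V"
  shows "distr lborel borel (\<lambda>\<theta>. V *v \<theta>) = lborel"
proof (rule measure_eqI)
  fix A assume "A \<in> sets (distr lborel borel (\<lambda>\<theta>. V *v \<theta>))"
  then have A[measurable]: "A \<in> sets borel" by simp
  define B where "B = ball (0 :: real ^ 'p) 1"
  have B[measurable]: "B \<in> sets borel" by (simp add: B_def)
  have T[measurable]: "(\<lambda>\<theta>. V *v \<theta>) \<in> borel_measurable borel"
    by (intro borel_measurable_continuous_onI matrix_vector_mult_linear_continuous_on)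
  have norm_V: "norm (V *v x) = norm x" for x
    using V by (metis orthogonal_transformation_matrix orthogonal_transformation_norm
        matrix_vector_mul_linear matrix_of_matrix_vector_mul)
  have VVt: "\<exists>z. V *v z = y" for y
    using V by (metis orthogonal_matrix_def matrix_vector_mul_assoc matrix_vector_mul_lid)
  have VB: "indicator B (V *v x) = (indicator B x :: ennreal)" for x
    by (simp add: B_def indicator_def norm_V)
  let ?I = "\<integral>\<^sup>+x. (\<integral>\<^sup>+y. indicator B (V *v x) * indicator A (V *v x + y) \<partial>lborel) \<partial>lborel"
  have "?I = (\<integral>\<^sup>+x. indicator B x * emeasure lborel A \<partial>lborel)"
    by (simp add: nn_integral_cmult nn_integral_lborel_shift VB)
  then have 1: "?I = emeasure lborel B * emeasure lborel A"
    by (simp add: nn_integral_multc)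
  have "?I = (\<integral>\<^sup>+y. (\<integral>\<^sup>+x. indicator B (V *v x) * indicator A (V *v x + y) \<partial>lborel) \<partial>lborel)"
    by (rule lborel_pair.Fubini') measurable
  also have "\<dots> = (\<integral>\<^sup>+y. (\<integral>\<^sup>+x. indicator B (V *v x - y) * indicator A (V *v x) \<partial>lborel) \<partial>lborel)"
  proof (rule nn_integral_cong)
    fix y :: "real ^ 'p"
    obtain z where z: "V *v z = y" using VVt by blast
    show "(\<integral>\<^sup>+x. indicator B (V *v x) * indicator A (V *v x + y) \<partial>lborel) =
      (\<integral>\<^sup>+x. indicator B (V *v x - y) * indicator A (V *v x) \<partial>lborel)"
      using nn_integral_lborel_shift[of "\<lambda>x. indicator B (V *v x - y) * indicator A (V *v x)"
          z]
      by (simp add: matrix_vector_right_distrib z add.commute)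
  qed
  also have "\<dots> = (\<integral>\<^sup>+x. (\<integral>\<^sup>+y. indicator B (V *v x - y) * indicator A (V *v x) \<partial>lborel) \<partial>lborel)"
    by (rule lborel_pair.Fubini') measurable
  also have "\<dots> = (\<integral>\<^sup>+x. (\<integral>\<^sup>+y. indicator B (- (V *v x) + y) \<partial>lborel) * indicator A (V *v x) \<partial>lborel)"
  proof (rule nn_integral_cong)
    fix x :: "real ^ 'p"
    have "indicator B (V *v x - y) = (indicator B (- (V *v x) + y) :: ennreal)" for y
      by (simp add: B_def indicator_def norm_minus_commute)
    then show "(\<integral>\<^sup>+y. indicator B (V *v x - y) * indicator A (V *v x) \<partial>lborel) =
      (\<integral>\<^sup>+y. indicator B (- (V *v x) + y) \<partial>lborel) * indicator A (V *v x)"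
      by (simp add: nn_integral_multc)
  qed
  also have "\<dots> = (\<integral>\<^sup>+x. emeasure lborel B * indicator A (V *v x) \<partial>lborel)"
    by (subst nn_integral_lborel_shift) simp_all
  also have "\<dots> = emeasure lborel B * (\<integral>\<^sup>+x. indicator A (V *v x) \<partial>lborel)"
    by (rule nn_integral_cmult) measurable
  also have "(\<integral>\<^sup>+x. indicator A (V *v x) \<partial>lborel) =
      (\<integral>\<^sup>+x. indicator A x \<partial>distr lborel borel (\<lambda>\<theta>. V *v \<theta>))"
    by (rule nn_integral_distr[symmetric]) simp_all
  also have "\<dots> = emeasure (distr lborel borel (\<lambda>\<theta>. V *v \<theta>)) A"
    by simp
  finally have 2: "?I = emeasure lborel B * emeasure (distr lborel borel (\<lambda>\<theta>. V *v \<theta>)) A" .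
  have "emeasure lborel B \<noteq> 0"
    unfolding B_def using content_ball_pos[of 1 "0 :: real ^ 'p"]
    by (metis less_irrefl measure_def enn2real_0 zero_less_one)
  moreover have "emeasure lborel B \<noteq> \<infinity>"
    unfolding B_def using emeasure_lborel_ball_finite by (metis less_irrefl infinity_ennreal_def)
  ultimately show "emeasure (distr lborel borel (\<lambda>\<theta>. V *v \<theta>)) A = emeasure lborel A"
    using 1 2 by (metis ennreal_mult_cancel_left infinity_ennreal_def)
qed simp

lemma rotationally_invariant_density:
  fixes r :: "real ^ 'p \<Rightarrow> real"
  assumes [measurable]: "r \<in> borel_measurable borel"
    and inv: "\<And>(V :: real ^ 'p ^ 'p) \<theta>. orthogonal_matrix V \<Longrightarrow> r \<theta> = r (V *v \<theta>)"
  shows "rotationally_invariant (density lborel r)"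
  unfolding rotationally_invariant_def
proof (intro allI impI)
  fix V :: "real ^ 'p ^ 'p"
  assume V: "orthogonal_matrix V"
  have [measurable]: "(\<lambda>\<theta>. V *v \<theta>) \<in> borel_measurable borel"
    by (intro borel_measurable_continuous_onI matrix_vector_mult_linear_continuous_on)
  have "density lborel r = density (distr lborel borel (\<lambda>\<theta>. V *v \<theta>)) r"
    by (simp add: distr_lborel_orthogonal[OF V])
  also have "\<dots> = distr (density lborel (\<lambda>\<theta>. r (V *v \<theta>))) borel (\<lambda>\<theta>. V *v \<theta>)"
    by (rule density_distr) simp_all
  also have "\<dots> = distr (density lborel r) borel (\<lambda>\<theta>. V *v \<theta>)"
    by (simp flip: inv[OF V])
  finally show "distr (density lborel r) borel (\<lambda>\<theta>. V *v \<theta>) = density lborel r" ..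
qed

definition orthonormal_eigenbasis :: "real ^ 'p ^ 'p \<Rightarrow> real ^ 'p ^ 'p \<Rightarrow> bool" where
  "orthonormal_eigenbasis A V \<longleftrightarrow>
     orthogonal_matrix V \<and> (\<forall>i. \<exists>l. A *v column i V = l *s column i V)"

definition kron_entry :: "real ^ 2 ^ 2 \<Rightarrow> nat \<Rightarrow> nat \<Rightarrow> nat \<Rightarrow> real" where
  "kron_entry A n a b =
     A $ (if a div n = 0 then 1 else 2) $ (if b div n = 0 then 1 else 2) *
     (if a mod n = b mod n then 1 else 0)"

text \<open>
  \<open>kron_entry A n a b\<close> is entry \<open>(a, b)\<close> of the Kronecker product of \<open>A\<close> with the identity of
  size \<open>n\<close>, for \<open>a, b < 2 * n\<close>.  Below, \<open>n = m 1\<close>, and the first \<open>2 * n\<close> positions of a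
  parameter vector hold \<open>vec W\<^sub>1\<close>.
\<close>

definition Q_matrix :: "nat \<Rightarrow> nat \<Rightarrow> (nat \<Rightarrow> 'p) \<Rightarrow> real \<Rightarrow> real ^ 'p ^ 'p" where
  "Q_matrix p n e \<gamma> =
     (\<chi> i j. let a = inv_into {..<p} e i; b = inv_into {..<p} e j in
        if a < 2 * n \<and> b < 2 * n then kron_entry (transpose (rot2 \<gamma>)) n a b
        else if a = b then 1 else 0)"

text \<open>
  An algorithm is its update function, which gets the lists of all past iterates and of the
  gradients of the objective at them, oldest first.
\<close>

fun iterate ::
  "('a::euclidean_space list \<Rightarrow> 'a list \<Rightarrow> 'a) \<Rightarrow> ('a \<Rightarrow> real) \<Rightarrow> 'a \<Rightarrow> nat \<Rightarrow> 'a" where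
  "iterate update l \<theta>0 0 = \<theta>0"
| "iterate update l \<theta>0 (Suc t) =
     update (map (\<lambda>\<tau>. iterate update l \<theta>0 \<tau>) [0..<Suc t])
       (map (\<lambda>\<tau>. gradient l (iterate update l \<theta>0 \<tau>)) [0..<Suc t])"

end

theory Submission
  imports Defs
begin

text \<open>
  Rotating the input of a network amounts to applying the orthogonal matrix \<open>Q\<close> to its
  parameters, so the loss on the rotated data is the unrotated loss composed with \<open>Q\<close>.  By
  the chain rule and the rotation invariance of \<open>\<rho>\<close> its EGOP matrix is \<open>Q\<^sup>T E Q\<close>, hence the
  convention on eigenbases yields \<open>V\<^sub>\<gamma> = Q\<^sup>T V\<^sub>0\<close>.  The reparameterized
  objectives are then the same function for every \<open>\<gamma>\<close>, whence so are the iterates.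
\<close>

section \<open>Gradients and EGOP matrices under a linear change of parameters\<close>

lemma GDERIV_unique:
  assumes "GDERIV l x :> a" "GDERIV l x :> b"
  shows "a = b"
proof -
  have "(\<lambda>h. h \<bullet> a) = (\<lambda>h. h \<bullet> b)"
    using assms unfolding gderiv_def by (rule has_derivative_unique)
  \<comment> \<open>The two functionals are compared at the vector \<open>a - b\<close>.\<close>
  then have "(a - b) \<bullet> a = (a - b) \<bullet> b"
    by metis
  then have "(a - b) \<bullet> (a - b) = 0"
    by (simp add: inner_diff_right)
  then show ?thesis
    by simp
qed

lemma gradient_eqI: "GDERIV l x :> g \<Longrightarrow> gradient l x = g"
  unfolding gradient_def by (blast intro: GDERIV_unique)

text \<open>Riesz representation: the derivative \<open>l'\<close> is a linear functional, and the
  vector representing it is \<open>adjoint l' 1\<close>.\<close>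

lemma GDERIV_gradient:
  fixes l :: "'a::euclidean_space \<Rightarrow> real"
  assumes "l differentiable (at x)"
  shows "GDERIV l x :> gradient l x"
proof -
  obtain l' where l': "(l has_derivative l') (at x)"
    using assms by (auto simp: differentiable_def)
  have lin: "linear l'"
    using l' by (rule has_derivative_linear)
  have "l' = (\<lambda>h. h \<bullet> adjoint l' 1)"
    by (simp add: adjoint_works[OF lin])
  then have "GDERIV l x :> adjoint l' 1"
    using l' unfolding gderiv_def by metis
  then show ?thesis
    using gradient_eqI by metis
qed

text \<open>Chain rule; the transpose arises from moving \<open>A\<close> to the other side of the
  inner product.\<close>

lemma gradient_compose_matrix:
  fixes l :: "real ^ 'm \<Rightarrow> real" and A :: "real ^ 'n ^ 'm"
  assumes "l differentiable (at (A *v x))"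
  shows "gradient (\<lambda>z. l (A *v z)) x = transpose A *v gradient l (A *v x)"
proof (rule gradient_eqI)
  have "(l has_derivative (\<lambda>h. h \<bullet> gradient l (A *v x))) (at (A *v x))"
    using GDERIV_gradient[OF assms] by (simp add: gderiv_def)
  moreover have "((\<lambda>z. A *v z) has_derivative (\<lambda>h. A *v h)) (at x)"
    by (intro bounded_linear_imp_has_derivative matrix_vector_mul_bounded_linear)
  ultimately have "((\<lambda>z. l (A *v z)) has_derivative (\<lambda>h. (A *v h) \<bullet> gradient l (A *v x))) (at x)"
    by (rule has_derivative_compose[rotated])
  moreover have "(A *v h) \<bullet> g = h \<bullet> (transpose A *v g)" for h g
    by (metis dot_lmul_matrix inner_commute transpose_matrix_vector)
  ultimately show "GDERIV (\<lambda>z. l (A *v z)) x :> transpose A *v gradient l (A *v x)"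
    by (simp only: gderiv_def)
qed

lemma grad_outer_compose_matrix:
  fixes l :: "real ^ 'm \<Rightarrow> real" and A :: "real ^ 'n ^ 'm"
  assumes "l differentiable (at (A *v x))"
  shows "grad_outer (\<lambda>z. l (A *v z)) x = transpose A ** grad_outer l (A *v x) ** A"
proof -
  have col: "columnvector (transpose A *v v) = transpose A ** (columnvector v :: real ^ 1 ^ 'm)" for v
    by (simp add: columnvector_def matrix_matrix_mult_def matrix_vector_mult_def)
  have row: "rowvector (transpose A *v v) = (rowvector v :: real ^ 'm ^ 1) ** A" for v
    by (simp add: rowvector_def matrix_matrix_mult_def matrix_vector_mult_def transpose_def
        mult.commute)
  show ?thesis
    by (simp only: grad_outer_def gradient_compose_matrix[OF assms] col row matrix_mul_assoc)
qed

text \<open>The integrand is the conjugate by \<open>Q\<close> of \<open>grad_outer l\<close> at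
  \<open>Q *v \<theta>\<close>. Conjugation comes out of the integral by linearity, and the shift of
  the argument disappears because \<open>Q\<close> preserves \<open>\<rho>\<close>.\<close>

lemma EGOP_compose_orthogonal:
  fixes l :: "real ^ 'p \<Rightarrow> real" and Q :: "real ^ 'p ^ 'p"
  assumes sets: "sets \<rho> = sets borel" and inv: "rotationally_invariant \<rho>"
    and wd: "EGOP_well_defined \<rho> l" and Q: "orthogonal_matrix Q"
  shows "EGOP \<rho> (\<lambda>z. l (Q *v z)) = transpose Q ** EGOP \<rho> l ** Q"
proof -
  have int: "integrable \<rho> (grad_outer l)" and diff: "l differentiable (at \<theta>)" for \<theta>
    using wd by (auto simp: EGOP_well_defined_def)
  have [measurable]: "(\<lambda>\<theta>. Q *v \<theta>) \<in> measurable \<rho> borel"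
    unfolding measurable_cong_sets[OF sets refl]
    by (intro borel_measurable_continuous_onI matrix_vector_mult_linear_continuous_on)
  have [measurable]: "grad_outer l \<in> borel_measurable borel"
    using borel_measurable_integrable[OF int] sets by (simp cong: measurable_cong_sets)
  have distr: "distr \<rho> borel (\<lambda>\<theta>. Q *v \<theta>) = \<rho>"
    using inv Q by (simp add: rotationally_invariant_def)
  have int': "integrable \<rho> (\<lambda>\<theta>. grad_outer l (Q *v \<theta>))"
    using int integrable_distr_eq[of "\<lambda>\<theta>. Q *v \<theta>" \<rho> borel "grad_outer l"]
    by (simp add: distr)
  have "(\<integral>\<theta>. grad_outer l (Q *v \<theta>) \<partial>\<rho>) = (\<integral>\<theta>. grad_outer l \<theta> \<partial>distr \<rho> borel (\<lambda>\<theta>. Q *v \<theta>))"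
    by (rule integral_distr[symmetric]) measurable
  then have eq: "(\<integral>\<theta>. grad_outer l (Q *v \<theta>) \<partial>\<rho>) = EGOP \<rho> l"
    by (simp add: distr EGOP_def)
  have "linear (\<lambda>M. transpose Q ** M ** Q)"
    by (rule linearI) (simp_all add: vec_eq_iff matrix_matrix_mult_def sum.distrib
        sum_distrib_left sum_distrib_right distrib_left distrib_right mult_ac)
  then have "bounded_linear (\<lambda>M. transpose Q ** M ** Q)"
    by (simp add: linear_conv_bounded_linear)
  from integral_bounded_linear[OF this int'] show ?thesis
    by (simp add: EGOP_def[of _ "\<lambda>z. l (Q *v z)"] grad_outer_compose_matrix[OF diff] eq)
qed

section \<open>Plane rotations and the rotated data law\<close>

lemma rot2_entries:
  "rot2 \<gamma> $ 1 $ 1 = cos \<gamma>" "rot2 \<gamma> $ 1 $ 2 = - sin \<gamma>"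
  "rot2 \<gamma> $ 2 $ 1 = sin \<gamma>" "rot2 \<gamma> $ 2 $ 2 = cos \<gamma>"
  by (simp_all add: rot2_def)

lemma transpose_rot2: "transpose (rot2 \<gamma>) = rot2 (- \<gamma>)"
  by (simp add: vec_eq_iff forall_2 transpose_def rot2_entries)

lemma rot2_0_vector: "rot2 0 *v x = x"
  by (simp add: vec_eq_iff forall_2 matrix_vector_mult_def sum_2 rot2_entries)

text \<open>The Pythagorean identity, in the nested form that arises when two opposite rotations are
  multiplied out.\<close>

lemma cos_sin_cancel: "cos \<gamma> * (cos \<gamma> * u) + sin \<gamma> * (sin \<gamma> * u) = u" for u :: real
  using sin_cos_squared_add3[of \<gamma>] by (metis distrib_right mult.assoc mult_1)

lemma rot2_cancel: "rot2 \<gamma> *v (transpose (rot2 \<gamma>) *v x) = x"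
  by (simp add: cos_sin_cancel vec_eq_iff forall_2 matrix_vector_mult_def sum_2 rot2_entries
      transpose_def algebra_simps)

lemma sets_data_law: "sets (data_law \<mu>1 \<mu>2 \<mu>3 s) = sets borel"
  unfolding data_law_def by (rule sets_bind) (auto split: prod.split)

text \<open>Change of variables. As \<open>g\<close> is arbitrary, the measurability of the
  integrand is drawn from the integrability assumption.\<close>

lemma loss_rotated_law:
  assumes "sets D = sets borel" "integrable (rotated_law \<gamma> D) (\<lambda>(x, y). - y * g \<theta> x)"
  shows "loss (rotated_law \<gamma> D) g \<theta> = (\<integral>(x, y). - y * g \<theta> (rot2 \<gamma> *v x) \<partial>D)"
proof -
  have "(\<lambda>(x :: real ^ 2, y :: real). (rot2 \<gamma> *v x, y)) \<in> measurable borel borel"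
    unfolding split_beta
    by (intro borel_measurable_continuous_onI continuous_intros
        matrix_vector_mult_linear_continuous_on[THEN continuous_on_compose2]) auto
  then have 1: "(\<lambda>(x :: real ^ 2, y :: real). (rot2 \<gamma> *v x, y)) \<in> measurable D borel"
    by (simp add: measurable_cong_sets[OF assms(1) refl])
  have 2: "(\<lambda>(x, y). - y * g \<theta> x) \<in> borel_measurable borel"
    using borel_measurable_integrable[OF assms(2)] by (simp add: rotated_law_def)
  show ?thesis
    unfolding loss_def rotated_law_def by (subst integral_distr[OF 1 2]) (simp add: case_prod_unfold)
qed

section \<open>The block matrix acting on the first weight block\<close>

lemma transpose_Q_matrix: "transpose (Q_matrix p n e \<gamma>) = Q_matrix p n e (- \<gamma>)"
  by (auto simp: vec_eq_iff Q_matrix_def transpose_def Let_def kron_entry_def rot2_entries)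

text \<open>Reindexing along \<open>e\<close> replaces the sum over the unordered type
  \<open>'p\<close> by a sum over positions, where \<open>div\<close> and \<open>mod\<close> can be
  used.\<close>

lemma Q_matrix_vector:
  assumes e: "bij_betw e {..<p} (UNIV :: 'p::finite set)" and a: "a < p"
  shows "(Q_matrix p n e \<gamma> *v \<theta>) $ e a =
    (\<Sum>b<p. (if a < 2 * n \<and> b < 2 * n then kron_entry (transpose (rot2 \<gamma>)) n a b
       else if a = b then 1 else 0) * \<theta> $ e b)"
proof -
  have inv: "inv_into {..<p} e (e b) = b" if "b < p" for b
    using e that by (simp add: bij_betw_inv_into_left)
  have "(Q_matrix p n e \<gamma> *v \<theta>) $ e a = (\<Sum>j\<in>UNIV. Q_matrix p n e \<gamma> $ e a $ j * \<theta> $ j)"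
    by (simp add: matrix_vector_mult_def)
  also have "\<dots> = (\<Sum>b<p. Q_matrix p n e \<gamma> $ e a $ e b * \<theta> $ e b)"
    by (rule sum.reindex_bij_betw[OF e, symmetric])
  also have "\<dots> = (\<Sum>b<p. (if a < 2 * n \<and> b < 2 * n then kron_entry (transpose (rot2 \<gamma>)) n a b
       else if a = b then 1 else 0) * \<theta> $ e b)"
    by (rule sum.cong) (simp_all add: Q_matrix_def inv a Let_def)
  finally show ?thesis .
qed

lemma Q_matrix_vector_ge:
  assumes "bij_betw e {..<p} (UNIV :: 'p::finite set)" "a < p" "2 * n \<le> a"
  shows "(Q_matrix p n e \<gamma> *v \<theta>) $ e a = \<theta> $ e a"
proof -
  have "(Q_matrix p n e \<gamma> *v \<theta>) $ e a = (\<Sum>b<p. if a = b then \<theta> $ e b else 0)"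
    unfolding Q_matrix_vector[OF assms(1,2)] using assms(3) by (intro sum.cong) auto
  then show ?thesis
    using assms(2) by simp
qed

text \<open>In column-major order, row \<open>r\<close> of the first weight matrix sits at positions
  \<open>r\<close> and \<open>n + r\<close>. The right-hand sides are the entries of that row after
  multiplying the matrix by \<open>rot2 \<gamma>\<close> from the right.\<close>

lemma Q_matrix_vector_less:
  assumes e: "bij_betw e {..<p} (UNIV :: 'p::finite set)" and n: "2 * n \<le> p" and r: "r < n"
  shows "(Q_matrix p n e \<gamma> *v \<theta>) $ e r = cos \<gamma> * \<theta> $ e r + sin \<gamma> * \<theta> $ e (n + r)"
    and "(Q_matrix p n e \<gamma> *v \<theta>) $ e (n + r) = - sin \<gamma> * \<theta> $ e r + cos \<gamma> * \<theta> $ e (n + r)"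
proof -
  have reduce: "(Q_matrix p n e \<gamma> *v \<theta>) $ e a =
      kron_entry (transpose (rot2 \<gamma>)) n a r * \<theta> $ e r +
      kron_entry (transpose (rot2 \<gamma>)) n a (n + r) * \<theta> $ e (n + r)"
    if a: "a < 2 * n" "a mod n = r" for a
  proof -
    \<comment> \<open>The identity factor of the Kronecker product kills every column not congruent
      to \<open>r\<close> modulo \<open>n\<close>; below \<open>2 * n\<close> only \<open>r\<close>
      and \<open>n + r\<close> survive.\<close>
    have zero: "kron_entry (transpose (rot2 \<gamma>)) n a b = 0"
      if b: "b < 2 * n" "b \<noteq> r" "b \<noteq> n + r" for b
    proof -
      have "b mod n = (if b < n then b else b - n)"
        using b by (simp add: mod_if)
      then have "b mod n \<noteq> r"
        using b by auto
      then show ?thesis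
        using a by (simp add: kron_entry_def)
    qed
    have "a < p"
      using a n by simp
    then have "(Q_matrix p n e \<gamma> *v \<theta>) $ e a =
        (\<Sum>b<p. (if a < 2 * n \<and> b < 2 * n then kron_entry (transpose (rot2 \<gamma>)) n a b
           else if a = b then 1 else 0) * \<theta> $ e b)"
      by (rule Q_matrix_vector[OF e])
    also have "\<dots> = (\<Sum>b\<in>{r, n + r}. (if a < 2 * n \<and> b < 2 * n then
        kron_entry (transpose (rot2 \<gamma>)) n a b else if a = b then 1 else 0) * \<theta> $ e b)"
      using n r a zero by (intro sum.mono_neutral_right) auto
    also have "\<dots> = kron_entry (transpose (rot2 \<gamma>)) n a r * \<theta> $ e r +
        kron_entry (transpose (rot2 \<gamma>)) n a (n + r) * \<theta> $ e (n + r)"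
      using r a by simp
    finally show ?thesis .
  qed
  have div: "(n + r) div n = 1"
    using r by simp
  show "(Q_matrix p n e \<gamma> *v \<theta>) $ e r = cos \<gamma> * \<theta> $ e r + sin \<gamma> * \<theta> $ e (n + r)"
    using r by (simp add: reduce kron_entry_def transpose_def rot2_entries div)
  show "(Q_matrix p n e \<gamma> *v \<theta>) $ e (n + r) = - sin \<gamma> * \<theta> $ e r + cos \<gamma> * \<theta> $ e (n + r)"
    using r by (simp add: reduce kron_entry_def transpose_def rot2_entries div)
qed

text \<open>On each pair of positions \<open>r\<close>, \<open>n + r\<close> this is a product of
  two opposite rotations; all later positions are fixed.\<close>

lemma Q_matrix_cancel:
  assumes e: "bij_betw e {..<p} (UNIV :: 'p::finite set)" and n: "2 * n \<le> p"
  shows "Q_matrix p n e \<gamma> *v (Q_matrix p n e (- \<gamma>) *v \<theta>) = \<theta>"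
proof -
  have "(Q_matrix p n e \<gamma> *v (Q_matrix p n e (- \<gamma>) *v \<theta>)) $ e a = \<theta> $ e a" if a: "a < p" for a
  proof -
    \<comment> \<open>First column of the first weight matrix, second column, and all remaining
      parameters.\<close>
    consider "a < n" | r where "r < n" "a = n + r" | "2 * n \<le> a"
      by (metis add_less_cancel_left le_Suc_ex mult_2 not_le)
    then show ?thesis
    proof cases
      case 1
      show ?thesis
        unfolding Q_matrix_vector_less[OF e n 1] by (simp add: cos_sin_cancel algebra_simps)
    next
      case 2
      show ?thesis
        unfolding 2(2) Q_matrix_vector_less[OF e n 2(1)] by (simp add: cos_sin_cancel algebra_simps)
    next
      case 3
      then show ?thesis
        by (simp add: Q_matrix_vector_ge[OF e a])
    qed
  qed
  moreover have "\<exists>a<p. i = e a" for i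
    using e by (force simp: bij_betw_def)
  ultimately show ?thesis
    unfolding vec_eq_iff by metis
qed

lemma orthogonal_Q_matrix:
  assumes "bij_betw e {..<p} (UNIV :: 'p::finite set)" "2 * n \<le> p"
  shows "orthogonal_matrix (Q_matrix p n e \<gamma>)"
proof -
  have "Q_matrix p n e \<gamma> ** Q_matrix p n e (- \<gamma>) = mat 1" for \<gamma>
    by (simp add: matrix_eq Q_matrix_cancel[OF assms] flip: matrix_vector_mul_assoc)
  \<comment> \<open>Transposition negates the angle, so the two signs give the two one-sided inverse
    equations.\<close>
  from this[of \<gamma>] this[of "- \<gamma>"] show ?thesis
    by (simp add: orthogonal_matrix_def transpose_Q_matrix)
qed

section \<open>Parameter layout and the action of the block matrix on the layers\<close>

lemma offset_less:
  fixes w :: "nat \<Rightarrow> nat"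
  assumes "1 \<le> j" "j \<le> N" "i < w j"
  shows "(\<Sum>k=1..<j. w k) + i < (\<Sum>k=1..N. w k)"
proof -
  have "(\<Sum>k=1..<j. w k) + i < (\<Sum>k=1..<Suc j. w k)"
    using assms by simp
  also have "\<dots> \<le> (\<Sum>k=1..N. w k)"
    using assms by (intro sum_mono2) auto
  finally show ?thesis .
qed

context
  fixes m :: "nat \<Rightarrow> nat" and L :: nat and e :: "nat \<Rightarrow> 'p::finite"
  assumes m0: "m 0 = 2" and e: "bij_betw e {..<num_params m L} UNIV"
begin

private abbreviation (input) "Q \<equiv> Q_matrix (num_params m L) (m 1) e"

text \<open>The summand at \<open>k = 1\<close> is \<open>m 1 * m 0\<close>, that is
  \<open>2 * m 1\<close>. Hence every weight block after the first starts beyond the positions that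
  \<open>Q\<close> moves.\<close>

lemma first_block_le_sum: "2 \<le> j \<Longrightarrow> 2 * m 1 \<le> (\<Sum>k=1..<j. m k * m (k - 1))"
  using member_le_sum[of 1 "{1..<j}" "\<lambda>k. m k * m (k - 1)"] m0 by (simp add: mult.commute)

lemma first_block_le: "2 * m 1 \<le> num_params m L"
  \<comment> \<open>The range \<open>{1..<L + 2}\<close> is \<open>{1..L + 1}\<close>, so this is
    the total size of the weight blocks.\<close>
  using first_block_le_sum[of "L + 2"]
  by (simp add: num_params_def atLeastLessThanSuc_atLeastAtMost)

lemma weight_index_less:
  assumes "j \<in> {1..L+1}" "r < m j" "c < m (j - 1)"
  shows "(\<Sum>k=1..<j. m k * m (k - 1)) + c * m j + r < num_params m L"
proof -
  \<comment> \<open>Entry \<open>r\<close> of column \<open>c\<close> lies before the start of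
    column \<open>c + 1\<close>, hence inside block \<open>j\<close>.\<close>
  have "c * m j + r < (c + 1) * m j"
    using assms by simp
  also have "\<dots> \<le> m j * m (j - 1)"
    using assms by (simp only: mult.commute[of "m j"] mult_le_mono1)
  finally have "(\<Sum>k=1..<j. m k * m (k - 1)) + (c * m j + r) < (\<Sum>k=1..L+1. m k * m (k - 1))"
    using assms by (intro offset_less) auto
  then show ?thesis
    by (simp add: num_params_def)
qed

lemma weight_Q:
  assumes "j \<in> {2..L+1}" "r < m j" "c < m (j - 1)"
  shows "weight m e (Q \<gamma> *v \<theta>) j r c = weight m e \<theta> j r c"
  unfolding weight_def
  using weight_index_less[of j r c] first_block_le_sum[of j] assms
  by (intro Q_matrix_vector_ge[OF e]) auto

lemma bias_Q:
  assumes "j \<in> {1..L+1}" "r < m j"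
  shows "bias m L e (Q \<gamma> *v \<theta>) j r = bias m L e \<theta> j r"
  unfolding bias_def
proof (rule Q_matrix_vector_ge[OF e])
  show "(\<Sum>k=1..L+1. m k * m (k - 1)) + (\<Sum>k=1..<j. m k) + r < num_params m L"
    using offset_less[of j "L + 1" r m] assms by (simp add: num_params_def)
  show "2 * m 1 \<le> (\<Sum>k=1..L+1. m k * m (k - 1)) + (\<Sum>k=1..<j. m k) + r"
    using first_block_le_sum[of "L + 2"] by (simp add: atLeastLessThanSuc_atLeastAtMost)
qed

text \<open>The inputs need only agree below the width \<open>m (j - 1)\<close>, since hidden
  vectors carry meaningless entries above it.\<close>

lemma affine_layer_Q:
  assumes "j \<in> {2..L+1}" "r < m j" "\<And>c. c < m (j - 1) \<Longrightarrow> v c = w c"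
  shows "affine_layer m L e (Q \<gamma> *v \<theta>) j v r = affine_layer m L e \<theta> j w r"
  unfolding affine_layer_def
proof (intro arg_cong2[where f = "(+)"] sum.cong refl)
  show "weight m e (Q \<gamma> *v \<theta>) j r c * v c = weight m e \<theta> j r c * w c" if "c \<in> {..<m (j - 1)}" for c
    using weight_Q[of j r c] assms that by (metis lessThan_iff)
  show "bias m L e (Q \<gamma> *v \<theta>) j r = bias m L e \<theta> j r"
    using assms by (intro bias_Q) auto
qed

text \<open>Associativity: a rotation multiplied into the first weight matrix from the right may be
  applied to the input instead.\<close>

lemma affine_layer_1_Q:
  assumes r: "r < m 1"
  shows "affine_layer m L e (Q \<gamma> *v \<theta>) 1 (\<lambda>i. if i = 0 then x $ 1 else x $ 2) r =
    affine_layer m L e \<theta> 1 (\<lambda>i. if i = 0 then (rot2 \<gamma> *v x) $ 1 else (rot2 \<gamma> *v x) $ 2) r"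
proof -
  have two: "(\<Sum>c<m (1 - 1). g c) = g 0 + g 1" for g :: "nat \<Rightarrow> real"
    by (simp add: m0 numeral_2_eq_2)
  have weights: "weight m e \<eta> 1 r 0 = \<eta> $ e r" "weight m e \<eta> 1 r 1 = \<eta> $ e (m 1 + r)" for \<eta>
    by (simp_all add: weight_def)
  have rot: "(rot2 \<gamma> *v x) $ 1 = cos \<gamma> * x $ 1 - sin \<gamma> * x $ 2"
    "(rot2 \<gamma> *v x) $ 2 = sin \<gamma> * x $ 1 + cos \<gamma> * x $ 2"
    by (simp_all add: matrix_vector_mult_def sum_2 rot2_entries)
  have "bias m L e (Q \<gamma> *v \<theta>) 1 r = bias m L e \<theta> 1 r"
    using r by (intro bias_Q) auto
  then show ?thesis
    unfolding affine_layer_def two weights Q_matrix_vector_less[OF e first_block_le r] rot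
    by (simp add: algebra_simps)
qed

text \<open>The induction starts at \<open>k = 1\<close>: at \<open>k = 0\<close> the two sides are
  the unrotated and the rotated input, and the first affine layer is what reconciles them.\<close>

lemma hidden_Q:
  assumes "1 \<le> k" "k \<le> L" "r < m k"
  shows "hidden m L act e (Q \<gamma> *v \<theta>) (\<lambda>i. if i = 0 then x $ 1 else x $ 2) k r =
    hidden m L act e \<theta> (\<lambda>i. if i = 0 then (rot2 \<gamma> *v x) $ 1 else (rot2 \<gamma> *v x) $ 2) k r"
  using assms
proof (induction k arbitrary: r rule: dec_induct)
  case base
  then show ?case
    using affine_layer_1_Q[of r \<gamma> \<theta> x] by simp
next
  case (step k)
  then have "affine_layer m L e (Q \<gamma> *v \<theta>) (k + 1)
      (hidden m L act e (Q \<gamma> *v \<theta>) (\<lambda>i. if i = 0 then x $ 1 else x $ 2) k) r =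
    affine_layer m L e \<theta> (k + 1)
      (hidden m L act e \<theta> (\<lambda>i. if i = 0 then (rot2 \<gamma> *v x) $ 1 else (rot2 \<gamma> *v x) $ 2) k) r"
    by (intro affine_layer_Q) auto
  then show ?case
    by simp
qed

text \<open>As \<open>1 \<le> L\<close>, the output layer is not the first one, so \<open>Q\<close>
  leaves its parameters unchanged.\<close>

lemma network_Q:
  assumes "1 \<le> L" "0 < m (L + 1)"
  shows "network m L act e (Q \<gamma> *v \<theta>) x = network m L act e \<theta> (rot2 \<gamma> *v x)"
  unfolding network_def using assms by (intro affine_layer_Q hidden_Q) auto

end

section \<open>Independence of the reparameterized objectives from the angle\<close>

theorem theorem4:
  fixes m :: "nat \<Rightarrow> nat" and L :: nat and act :: "nat \<Rightarrow> real \<Rightarrow> real"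
    and e :: "nat \<Rightarrow> 'p::finite"
    and \<mu>1 \<mu>2 \<mu>3 s :: real
    and \<rho> :: "(real ^ 'p) measure"
    and V :: "real \<Rightarrow> real ^ 'p ^ 'p"
    and update :: "(real ^ 'p) list \<Rightarrow> (real ^ 'p) list \<Rightarrow> real ^ 'p"
    and \<theta>0 :: "real ^ 'p" and T :: nat
    and f :: "real ^ 'p \<Rightarrow> real ^ 2 \<Rightarrow> real"
    and D :: "real \<Rightarrow> ((real ^ 2) \<times> real) measure"
    and f\<^sub>V :: "real \<Rightarrow> real ^ 'p \<Rightarrow> real ^ 2 \<Rightarrow> real"
    and \<theta> :: "real \<Rightarrow> nat \<Rightarrow> real ^ 'p"
  defines "f \<equiv> network m L act e"
    and "D \<equiv> \<lambda>\<gamma>. rotated_law \<gamma> (data_law \<mu>1 \<mu>2 \<mu>3 s)"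
    and "f\<^sub>V \<equiv> \<lambda>\<gamma>. reparam (V \<gamma>) f"
    and "\<theta> \<equiv> \<lambda>\<gamma>. iterate update (loss (D \<gamma>) (f\<^sub>V \<gamma>)) \<theta>0"
  assumes L: "1 \<le> L"
    and widths: "m 0 = 2" "\<And>j. j \<in> {1..L+1} \<Longrightarrow> 1 \<le> m j" "m (L + 1) = 1"
    and coordinates: "bij_betw e {..<num_params m L} UNIV"
    and noise: "0 < s"
    and sampling: "prob_space \<rho>" "sets \<rho> = sets borel" "rotationally_invariant \<rho>"
    and loss_finite: "\<And>\<gamma> \<eta>. integrable (D \<gamma>) (\<lambda>(x, y). - y * f \<eta> x)"
    and egop: "\<And>\<gamma>. EGOP_well_defined \<rho> (loss (D \<gamma>) f)"
    and eigenbasis: "\<And>\<gamma>. orthonormal_eigenbasis (EGOP \<rho> (loss (D \<gamma>) f)) (V \<gamma>)"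
    and consistent: "\<And>\<gamma> Q. Q = Q_matrix (num_params m L) (m 1) e \<gamma> \<Longrightarrow>
      EGOP \<rho> (loss (D \<gamma>) f) = transpose Q ** EGOP \<rho> (loss (D 0) f) ** Q \<Longrightarrow>
      V \<gamma> = transpose Q ** V 0"
  shows "(\<forall>\<gamma> x. \<forall>t\<in>{1..T}. f\<^sub>V \<gamma> (\<theta> \<gamma> t) x = f\<^sub>V 0 (\<theta> 0 t) (transpose (rot2 \<gamma>) *v x)) \<and>
    (\<forall>\<gamma>. \<forall>t\<in>{1..T}. \<theta> \<gamma> t = \<theta> 0 t)"
proof -
  let ?Q = "Q_matrix (num_params m L) (m 1) e"
  note e = coordinates
  have orth: "orthogonal_matrix (?Q \<gamma>)" for \<gamma>
    using orthogonal_Q_matrix[OF e first_block_le[OF widths(1) e]] .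
  have f_Q: "f (?Q \<gamma> *v \<eta>) x = f \<eta> (rot2 \<gamma> *v x)" for \<gamma> \<eta> x
    unfolding f_def using network_Q[OF widths(1) e L] widths(3) by simp
  \<comment> \<open>Every loss becomes an integral over the same unrotated law, so that different
    angles, including \<open>0\<close>, can be compared.\<close>
  have loss_eq: "loss (D \<gamma>) f \<eta> =
      (\<integral>(x, y). - y * f \<eta> (rot2 \<gamma> *v x) \<partial>data_law \<mu>1 \<mu>2 \<mu>3 s)" for \<gamma> \<eta>
    using loss_rotated_law[OF sets_data_law loss_finite[unfolded D_def]]
    by (simp add: D_def)
  have loss_Q: "loss (D \<gamma>) f = (\<lambda>\<eta>. loss (D 0) f (?Q \<gamma> *v \<eta>))" for \<gamma>
    by (rule ext) (simp only: loss_eq f_Q rot2_0_vector)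
  have "EGOP \<rho> (loss (D \<gamma>) f) = transpose (?Q \<gamma>) ** EGOP \<rho> (loss (D 0) f) ** ?Q \<gamma>" for \<gamma>
    using EGOP_compose_orthogonal[OF sampling(2,3) egop orth] by (subst loss_Q)
  then have V: "V \<gamma> = transpose (?Q \<gamma>) ** V 0" for \<gamma>
    by (rule consistent[OF refl])
  \<comment> \<open>The factor \<open>transpose (?Q \<gamma>)\<close> in \<open>V \<gamma>\<close>
    cancels against \<open>?Q \<gamma>\<close>; this removes the angle from the objective.\<close>
  have QV: "?Q \<gamma> *v (V \<gamma> *v \<eta>) = V 0 *v \<eta>" for \<gamma> \<eta>
    using orth[of \<gamma>] by (simp add: V[of \<gamma>] orthogonal_matrix_def matrix_vector_mul_assoc
        matrix_mul_assoc)
  have "loss (D \<gamma>) (f\<^sub>V \<gamma>) \<eta> = loss (D \<gamma>) f (V \<gamma> *v \<eta>)" for \<gamma> \<eta>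
    by (simp add: loss_def f\<^sub>V_def reparam_def)
  then have "loss (D \<gamma>) (f\<^sub>V \<gamma>) = loss (D 0) (f\<^sub>V 0)" for \<gamma>
    unfolding fun_eq_iff by (metis loss_Q QV)
  then have \<theta>: "\<theta> \<gamma> t = \<theta> 0 t" for \<gamma> t
    unfolding \<theta>_def by metis
  \<comment> \<open>Writing \<open>x\<close> as the rotation of
    \<open>transpose (rot2 \<gamma>) *v x\<close> lets \<open>f_Q\<close> move the rotation into the
    parameters, where \<open>QV\<close> turns \<open>V \<gamma>\<close> into
    \<open>V 0\<close>.\<close>
  have "f\<^sub>V \<gamma> \<eta> x = f\<^sub>V 0 \<eta> (transpose (rot2 \<gamma>) *v x)" for \<gamma> \<eta> x
    using f_Q[of \<gamma> "V \<gamma> *v \<eta>" "transpose (rot2 \<gamma>) *v x"]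
    by (simp only: f\<^sub>V_def reparam_def QV rot2_cancel)
  with \<theta> show ?thesis
    by metis
qed

end
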